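(* Let $K$ be an arbitrary field. Let $a(t)=\sum_{n\geq 0}a_nt^n$ be a power series with nonnegative integer coefficients, and let $d$ be a positive integer such that \[ a_n\leq \binom{d+n-1}{n},\quad n=0,1,2,\ldots. \] Then for any integer $p\in\{0,1,2\}$ there exists a $(d+1)$-generated graded algebra $R$ over $K$ such that its Hilbert series is \[ H(R,t)=\frac{1}{(1-t)^d}+\frac{t}{(1-t)^{2d}}+\frac{t^2a(t)}{(1-t)^{dp}}. \]
   Context: Algebras are unitary associative algebras over a field $K$ of any characteristic. A graded algebra is an algebra $R$ that is a direct sum of vector subspaces $R=R_0\oplus R_1\oplus R_2\oplus\cdots$ with $R_mR_n\subset R_{m+n}$ for all $m,n\geq 0$; it is assumed throughout that $R_0=0$ or $R_0=K$ and that the algebra generators of $R$ are of first degree. Thus an $m$-generated graded algebra is one generated as a unitary algebra by $m$ elements of $R_1$, i.e. a factor algebra of the free unitary associative algebra $K\langle x_1,\ldots,x_m\rangle$ (with each $x_i$ of degree $1$) modulo a homogeneous two-sided ideal. The Hilbert series of $R$ is the formal power series $H(R,t)=\sum_{n\geq 0}\dim_K(R_n)\,t^n$. Rational expressions in $t$ are expanded as formal power series in $t$. *)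

theory Defs
  imports
    "HOL-Algebra.Subrings"
    "HOL-Computational_Algebra.Formal_Power_Series"
    "Jordan_Normal_Form.VS_Connect"
begin

text \<open>
  The locale \<open>algebra\<close> of \<open>HOL-Algebra.Module\<close> covers only commutative algebras, so unitary
  associative algebras are introduced here on top of the same record type.
\<close>

locale assoc_algebra = V: vectorspace K R + R: ring R
  for K :: "'k ring" and R :: "('k, 'a) module" (structure) +
  assumes smult_mult_left:
      "\<And>c x y. \<lbrakk>c \<in> carrier K; x \<in> carrier R; y \<in> carrier R\<rbrakk>
        \<Longrightarrow> (c \<odot> x) \<otimes> y = c \<odot> (x \<otimes> y)"
    and smult_mult_right:
      "\<And>c x y. \<lbrakk>c \<in> carrier K; x \<in> carrier R; y \<in> carrier R\<rbrakk>
        \<Longrightarrow> x \<otimes> (c \<odot> y) = c \<odot> (x \<otimes> y)"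

text \<open>
  Since \<open>subring\<close> requires the unit, this is the subalgebra generated by \<open>X\<close> as a unitary algebra.
\<close>

definition generated_subalgebra :: "'k ring \<Rightarrow> ('k, 'a) module \<Rightarrow> 'a set \<Rightarrow> 'a set" where
  "generated_subalgebra K R X =
     \<Inter> {S. subring S R \<and> VectorSpace.subspace K S R \<and> X \<subseteq> S}"

text \<open>
  The assumption \<open>direct_sum\<close> is the internal direct sum decomposition of the carrier: every element
  has a unique family of homogeneous components, almost all of them zero. In \<open>degree_zero\<close>, the
  second alternative is \<open>R\<^sub>0 = K\<close>, with \<open>K\<close> identified with the scalar multiples of the unit.
\<close>

locale graded_algebra = assoc_algebra K R
  for K :: "'k ring" and R :: "('k, 'a) module" (structure) +
  fixes G :: "nat \<Rightarrow> 'a set"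
  assumes component_subspace: "\<And>n. VectorSpace.subspace K (G n) R"
    and direct_sum:
      "\<And>x. x \<in> carrier R \<Longrightarrow>
        \<exists>!f. (\<forall>n. f n \<in> G n) \<and> finite {n. f n \<noteq> \<zero>} \<and>
             x = (\<Oplus>n \<in> {n. f n \<noteq> \<zero>}. f n)"
    and mult_component: "\<And>m n x y. \<lbrakk>x \<in> G m; y \<in> G n\<rbrakk> \<Longrightarrow> x \<otimes> y \<in> G (m + n)"
    and degree_zero: "G 0 = {\<zero>} \<or> G 0 = {c \<odot> \<one> | c. c \<in> carrier K}"
    and degree_one_generates: "generated_subalgebra K R (G 1) = carrier R"

text \<open>The generators form a family, so they are not required to be distinct.\<close>

definition generated_graded_algebra ::
  "nat \<Rightarrow> 'k ring \<Rightarrow> ('k, 'a) module \<Rightarrow> (nat \<Rightarrow> 'a set) \<Rightarrow> bool" where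
  "generated_graded_algebra m K R G \<longleftrightarrow>
     graded_algebra K R G \<and>
     (\<exists>x :: nat \<Rightarrow> 'a. x ` {..<m} \<subseteq> G 1 \<and>
        generated_subalgebra K R (x ` {..<m}) = carrier R)"

text \<open>
  \<open>vectorspace.dim\<close> is meaningful only in finite dimension; all components of a finitely generated
  graded algebra are finite-dimensional. The coefficients are taken in the field of rationals so
  that rational expressions in \<open>t\<close> can be written with the division of formal power series.
\<close>

definition hilbert_series ::
  "'k ring \<Rightarrow> ('k, 'a) module \<Rightarrow> (nat \<Rightarrow> 'a set) \<Rightarrow> rat fps" where
  "hilbert_series K R G =
     Abs_fps (\<lambda>n. of_nat (vectorspace.dim K (R\<lparr>carrier := G n\<rparr>)))"

text \<open>
  Every \<open>m\<close>-generated algebra over \<open>'k\<close> is a quotient of the free algebra, so it has a basis of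
  words in the letters \<open>0, \<dots>, m - 1\<close> and is isomorphic to one whose elements are coefficient
  functions on words. The following carrier type is therefore large enough for all of them.
\<close>

type_synonym 'k word_algebra = "('k, nat list \<Rightarrow> 'k) module"

end

theory Submission
  imports Defs
begin

text \<open>
  Take commuting generators \<open>x\<^sub>0, \<dots>, x\<^sub>d\<^sub>-\<^sub>1\<close> and one more generator \<open>y\<close>
  that satisfies no commutation relation. Modulo the commutators, the words with no \<open>y\<close> are the
  monomials \<open>u\<close> in \<open>d\<close> commuting variables, with series \<open>1 / (1 - t)\<^sup>d\<close>; those with one \<open>y\<close> are
  the \<open>u y v\<close>, with series \<open>t / (1 - t)\<^sup>2\<^sup>d\<close>; those with two are the \<open>u y v y z\<close>. There are
  \<open>(d + n - 1) choose n\<close> monomials of degree \<open>n\<close>, so by the bound on \<open>a\<close> one can choose a set \<open>W\<close>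
  of monomials with exactly \<open>a n\<close> members of degree \<open>n\<close>. Impose that a word with three \<open>y\<close> is zero and
  that \<open>y v y = 0\<close> for \<open>v \<notin> W\<close>; for \<open>p \<le> 1\<close> impose also \<open>y v y x\<^sub>i = 0\<close>, and for \<open>p = 0\<close> also
  \<open>x\<^sub>i y v y = 0\<close>. The middle factor then contributes \<open>a(t)\<close> and exactly \<open>p\<close> of the outer factors
  \<open>u\<close> and \<open>z\<close> remain free, which gives the third summand \<open>t\<^sup>2 a(t) / (1 - t)\<^sup>d\<^sup>p\<close>.

  All relations equate two words or kill a word, so the quotient has a basis of words over any
  field and its Hilbert series merely counts normal words. This is the content of the locale
  \<open>monomial_quotient\<close>, with \<open>dim_component\<close> for the dimensions. The normal form for the commutation
  relations sorts the blocks between consecutive \<open>y\<close>; \<open>normal_surviving\<close> lists the normal words and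
  \<open>word_series_normal_surviving\<close> counts them.
\<close>

(* From here on, mult is the record field of a monoid. *)
hide_const (open) Multiset.mult

section \<open>Algebras presented by word identities and zero words\<close>

text \<open>
  A congruence on words, given by its normal form map \<open>nf\<close>, together with the set \<open>M\<close> of words that
  stay nonzero. That \<open>M\<close> is closed under factors says that the zero words form an ideal; that it is
  invariant under \<open>nf\<close> says that this ideal is compatible with the congruence. Words keep their
  length under \<open>nf\<close>, so the relations are homogeneous.
\<close>

locale monomial_quotient =
  fixes m :: nat and nf :: "nat list \<Rightarrow> nat list" and M :: "nat list set"
  assumes length_nf: "length (nf w) = length w"
    and nf_append_left: "nf (nf u @ v) = nf (u @ v)"
    and nf_append_right: "nf (u @ nf v) = nf (u @ v)"
    and nf_letter: "i < m \<Longrightarrow> nf [i] = [i]"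
    and nf_mem: "nf w \<in> M \<longleftrightarrow> w \<in> M"
    and append_memD1: "u @ v \<in> M \<Longrightarrow> u \<in> M"
    and append_memD2: "u @ v \<in> M \<Longrightarrow> v \<in> M"
    and Nil_mem: "[] \<in> M"
    and letter_mem: "i < m \<Longrightarrow> [i] \<in> M"
    and letters: "w \<in> M \<Longrightarrow> set w \<subseteq> {..<m}"
begin

lemma nf_idem: "nf (nf w) = nf w"
  using nf_append_left[of w "[]"] by simp

lemma nf_Nil: "nf [] = []"
  using length_nf[of "[]"] by simp

definition normal_words :: "nat list set" where
  "normal_words = {w \<in> M. nf w = w}"

text \<open>
  Being empty for \<open>w \<notin> M\<close>, this set makes products that fall outside \<open>M\<close> vanish. It is always
  finite, because \<open>nf\<close> keeps the length and the alphabet is finite; the product of two coefficient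
  functions is therefore a finite sum at each word, with no reference to their supports, and
  bilinearity is immediate.
\<close>
definition splits :: "nat list \<Rightarrow> (nat list \<times> nat list) set" where
  "splits w = {(u, v). u \<in> normal_words \<and> v \<in> normal_words \<and> nf (u @ v) = w \<and> w \<in> M}"

definition alg :: "'k::field word_algebra" where
  "alg = \<lparr>carrier = {f. (\<forall>w. f w \<noteq> 0 \<longrightarrow> w \<in> normal_words) \<and> finite {w. f w \<noteq> 0}},
          mult = (\<lambda>f g w. \<Sum>(u, v)\<in>splits w. f u * g v),
          one = (\<lambda>w. if w = [] then 1 else 0),
          zero = (\<lambda>w. 0),
          add = (\<lambda>f g w. f w + g w),
          smult = (\<lambda>c f w. c * f w)\<rparr>"

definition component :: "nat \<Rightarrow> (nat list \<Rightarrow> 'k::field) set" where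
  "component n = {f \<in> carrier alg. \<forall>w. f w \<noteq> 0 \<longrightarrow> length w = n}"

definition monom :: "nat list \<Rightarrow> nat list \<Rightarrow> 'k::field" where
  "monom u = (\<lambda>w. if w = u then 1 else 0)"

lemma alg_simps:
  "mult alg f g = (\<lambda>w. \<Sum>(u, v)\<in>splits w. f u * g v)"
  "one alg = monom []"
  "zero alg = (\<lambda>w. 0)"
  "add alg f g = (\<lambda>w. f w + g w)"
  "smult alg c f = (\<lambda>w. c * f w)"
  by (simp_all add: alg_def monom_def)

lemma carrier_alg:
  "f \<in> carrier alg \<longleftrightarrow> (\<forall>w. f w \<noteq> 0 \<longrightarrow> w \<in> normal_words) \<and> finite {w. f w \<noteq> 0}"
  by (simp add: alg_def)

lemma Nil_normal: "[] \<in> normal_words"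
  by (simp add: normal_words_def Nil_mem nf_Nil)

lemma letter_normal: "i < m \<Longrightarrow> [i] \<in> normal_words"
  by (simp add: normal_words_def letter_mem nf_letter)

lemma nf_normal: "w \<in> M \<Longrightarrow> nf w \<in> normal_words"
  by (simp add: normal_words_def nf_mem nf_idem)

lemma splitsD:
  assumes "(u, v) \<in> splits w"
  shows "u \<in> normal_words" "v \<in> normal_words" "nf (u @ v) = w" "w \<in> normal_words"
    "length w = length u + length v"
  using assms nf_idem length_nf[of "u @ v"] by (auto simp: splits_def normal_words_def)

lemma finite_normal_length: "finite {w \<in> normal_words. length w \<le> n}"
proof (rule finite_subset)
  show "{w \<in> normal_words. length w \<le> n} \<subseteq> {w. set w \<subseteq> {..<m} \<and> length w \<le> n}"
    using letters by (auto simp: normal_words_def)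
  show "finite {w. set w \<subseteq> {..<m} \<and> length w \<le> n}"
    by (rule finite_lists_length_le) simp
qed

lemma finite_normal_degree: "finite {w \<in> normal_words. length w = n}"
  by (rule finite_subset[OF _ finite_normal_length[of n]]) auto

lemma finite_splits [simp]: "finite (splits w)"
proof (rule finite_subset)
  let ?A = "{u \<in> normal_words. length u \<le> length w}"
  show "splits w \<subseteq> ?A \<times> ?A"
    by (auto dest: splitsD)
  show "finite (?A \<times> ?A)"
    using finite_normal_length by blast
qed

lemma mult_closed:
  assumes "f \<in> carrier alg" "g \<in> carrier alg"
  shows "mult alg f g \<in> carrier alg"
proof -
  have *: "\<exists>u v. f u \<noteq> 0 \<and> g v \<noteq> 0 \<and> (u, v) \<in> splits w" if "mult alg f g w \<noteq> 0" for w
  proof (rule ccontr)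
    assume "\<not> ?thesis"
    then have "(\<Sum>(u, v)\<in>splits w. f u * g v) = 0"
      by (intro sum.neutral) fastforce
    with that show False by (simp add: alg_simps)
  qed
  have "{w. mult alg f g w \<noteq> 0} \<subseteq> (\<lambda>(u, v). nf (u @ v)) ` ({u. f u \<noteq> 0} \<times> {v. g v \<noteq> 0})"
    by (force dest!: * dest: splitsD)
  moreover have "finite ({u. f u \<noteq> 0} \<times> {v. g v \<noteq> 0})"
    using assms by (simp add: carrier_alg)
  ultimately have "finite {w. mult alg f g w \<noteq> 0}"
    using finite_surj by blast
  moreover have "\<forall>w. mult alg f g w \<noteq> 0 \<longrightarrow> w \<in> normal_words"
    using * splitsD(4) by blast
  ultimately show ?thesis by (simp only: carrier_alg)
qed

lemma mult_degree:
  assumes "mult alg f g w \<noteq> 0" "\<And>u. f u \<noteq> 0 \<Longrightarrow> length u = i" "\<And>v. g v \<noteq> 0 \<Longrightarrow> length v = j"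
  shows "length w = i + j"
proof (rule ccontr)
  assume "length w \<noteq> i + j"
  then have "f u * g v = 0" if "(u, v) \<in> splits w" for u v
    using assms(2,3) splitsD(5)[OF that] by force
  then have "(\<Sum>(u, v)\<in>splits w. f u * g v) = 0"
    by (intro sum.neutral) auto
  with assms(1) show False by (simp add: alg_simps)
qed

text \<open>
  Both sides evaluate at \<open>w\<close> to the sum over all triples of basis words whose product is \<open>w\<close>: once the
  whole product is nonzero, so are the partial products, and their normal forms are determined.
\<close>
lemma mult_assoc:
  "mult alg (mult alg f g) h = mult alg f (mult alg g h)"
proof
  fix w
  define T where "T = {(a, b, c). a \<in> normal_words \<and> b \<in> normal_words \<and> c \<in> normal_words
    \<and> nf (a @ b @ c) = w \<and> w \<in> M}"
  have factor: "nf (a @ b) \<in> M" "nf (b @ c) \<in> M" "nf (a @ b) \<in> normal_words" "nf (b @ c) \<in> normal_words"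
    if "nf (a @ b @ c) \<in> M" for a b c
    using that nf_mem nf_normal append_memD1[of "a @ b" c] append_memD2[of a "b @ c"] by auto
  have "mult alg (mult alg f g) h w
      = (\<Sum>z\<in>splits w. \<Sum>y\<in>splits (fst z). f (fst y) * g (snd y) * h (snd z))"
    by (simp add: alg_simps sum_distrib_right case_prod_unfold)
  also have "\<dots> = (\<Sum>(z, y)\<in>(SIGMA z:splits w. splits (fst z)). f (fst y) * g (snd y) * h (snd z))"
    by (rule sum.Sigma) auto
  also have "\<dots> = (\<Sum>(a, b, c)\<in>T. f a * g b * h c)"
    by (rule sum.reindex_bij_witness[where j = "\<lambda>((x, c), (a, b)). (a, b, c)"
          and i = "\<lambda>(a, b, c). ((nf (a @ b), c), (a, b))"])
      (auto simp: splits_def T_def nf_append_left intro: factor)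
  also have "\<dots> = (\<Sum>(z, y)\<in>(SIGMA z:splits w. splits (snd z)). f (fst z) * (g (fst y) * h (snd y)))"
    by (rule sum.reindex_bij_witness[where i = "\<lambda>((a, x), (b, c)). (a, b, c)"
          and j = "\<lambda>(a, b, c). ((a, nf (b @ c)), (b, c))"])
      (auto simp: splits_def T_def nf_append_right mult.assoc intro: factor)
  also have "\<dots> = (\<Sum>z\<in>splits w. \<Sum>y\<in>splits (snd z). f (fst z) * (g (fst y) * h (snd y)))"
    by (rule sum.Sigma[symmetric]) auto
  also have "\<dots> = mult alg f (mult alg g h) w"
    by (simp add: alg_simps sum_distrib_left case_prod_unfold)
  finally show "mult alg (mult alg f g) h w = mult alg f (mult alg g h) w" .
qed

lemma mult_monom:
  assumes "u \<in> normal_words" "v \<in> normal_words" "u @ v \<in> M"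
  shows "mult alg (monom u) (monom v) = (monom (nf (u @ v)) :: nat list \<Rightarrow> 'k::field)"
proof
  fix w
  have "(\<Sum>(u', v')\<in>splits w. monom u u' * monom v v' :: 'k)
      = (\<Sum>z\<in>splits w. if z = (u, v) then 1 else 0)"
    by (rule sum.cong) (auto simp: monom_def split: if_splits)
  also have "\<dots> = (if (u, v) \<in> splits w then 1 else 0)"
    by simp
  also have "\<dots> = monom (nf (u @ v)) w"
    using assms nf_mem by (auto simp: splits_def monom_def)
  finally show "mult alg (monom u) (monom v) w = (monom (nf (u @ v)) w :: 'k)"
    by (simp add: alg_simps)
qed

lemma one_mult:
  assumes "f \<in> carrier alg"
  shows "mult alg (monom []) f = f" "mult alg f (monom []) = f"
proof -
  have *: "f w = 0" if "w \<notin> normal_words" for w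
    using assms that by (auto simp: carrier_alg)
  have "(\<Sum>(u, v)\<in>splits w. monom [] u * f v) = (\<Sum>z\<in>splits w. if z = ([], w) then f w else 0)" for w
    by (rule sum.cong) (auto simp: monom_def splits_def normal_words_def split: if_splits)
  moreover have "(\<Sum>(u, v)\<in>splits w. f u * monom [] v) = (\<Sum>z\<in>splits w. if z = (w, []) then f w else 0)" for w
    by (rule sum.cong) (auto simp: monom_def splits_def normal_words_def split: if_splits)
  moreover have "w \<in> normal_words \<Longrightarrow> ([], w) \<in> splits w \<and> (w, []) \<in> splits w" for w
    using Nil_normal by (auto simp: splits_def normal_words_def)
  ultimately show "mult alg (monom []) f = f" "mult alg f (monom []) = f"
    using * by (auto simp: alg_simps fun_eq_iff)
qed

lemma monom_carrier: "w \<in> normal_words \<Longrightarrow> monom w \<in> carrier alg"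
  by (auto simp: carrier_alg monom_def)

lemma add_closed:
  assumes "f \<in> carrier alg" "g \<in> carrier alg"
  shows "add alg f g \<in> carrier alg"
proof -
  have "finite {w. f w + g w \<noteq> 0}"
    by (rule finite_subset[of _ "{w. f w \<noteq> 0} \<union> {w. g w \<noteq> 0}"])
      (use assms in \<open>auto simp: carrier_alg\<close>)
  then show ?thesis
    using assms by (auto simp: carrier_alg alg_simps) (metis add.right_neutral)
qed

lemma smult_closed:
  assumes "f \<in> carrier alg"
  shows "smult alg c f \<in> carrier alg"
proof -
  have "finite {w. c * f w \<noteq> 0}"
    by (rule finite_subset[of _ "{w. f w \<noteq> 0}"]) (use assms in \<open>auto simp: carrier_alg\<close>)
  then show ?thesis
    using assms by (auto simp: carrier_alg alg_simps)
qed

lemma zero_carrier: "zero alg \<in> carrier alg"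
  by (simp add: carrier_alg alg_simps)

lemma abelian_group_alg: "abelian_group (alg :: 'k::field word_algebra)"
proof (rule abelian_groupI, goal_cases)
  case (6 x)
  show ?case
    by (rule bexI[of _ "smult alg (-1) x"]) (use smult_closed[OF 6, of "-1"] in \<open>auto simp: alg_simps\<close>)
qed (auto simp: add_closed zero_carrier, auto simp: alg_simps algebra_simps)

lemma ring_alg: "ring (alg :: 'k::field word_algebra)"
proof (rule ringI)
  show "abelian_group (alg :: 'k word_algebra)" by (rule abelian_group_alg)
  show "monoid (alg :: 'k word_algebra)"
    by (rule monoidI)
      (auto simp: mult_closed mult_assoc alg_simps(2) monom_carrier Nil_normal one_mult)
qed (simp_all add: alg_simps fun_eq_iff case_prod_unfold algebra_simps sum.distrib)

lemma vectorspace_alg: "vectorspace class_ring (alg :: 'k::field word_algebra)"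
  unfolding vectorspace_def
  by (intro conjI class_field moduleI abelian_group_alg)
    (auto simp: smult_closed class_cring.is_cring, auto simp: alg_simps algebra_simps)

lemma assoc_algebra_alg: "assoc_algebra class_ring (alg :: 'k::field word_algebra)"
  by (intro assoc_algebra.intro vectorspace_alg ring_alg assoc_algebra_axioms.intro)
    (auto simp: alg_simps sum_distrib_left case_prod_unfold algebra_simps)

lemma component_subspace:
  "VectorSpace.subspace class_ring (component n) (alg :: 'k::field word_algebra)"
  unfolding VectorSpace.subspace_def
proof (intro conjI vectorspace_alg submodule.intro)
  show "module class_ring (alg :: 'k word_algebra)"
    using vectorspace_alg vectorspace_def by blast
qed (auto simp: component_def add_closed zero_carrier smult_closed,
    auto simp: alg_simps, metis add.right_neutral)

lemma finsum_alg:
  assumes "finite A" "F \<in> A \<rightarrow> carrier alg"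
  shows "finsum (alg :: 'k::field word_algebra) F A = (\<lambda>w. \<Sum>i\<in>A. F i w)"
  using assms
proof (induction A)
  case empty
  interpret abelian_group "alg :: 'k word_algebra" by (rule abelian_group_alg)
  show ?case by (simp add: alg_simps)
next
  case (insert x A)
  interpret abelian_group "alg :: 'k word_algebra" by (rule abelian_group_alg)
  have "finsum alg F (insert x A) = add alg (F x) (finsum alg F A)"
    using insert by (intro finsum_insert) auto
  with insert show ?case by (simp add: alg_simps)
qed

text \<open>
  The component of degree \<open>n\<close> of a coefficient function can only be its restriction to the words of
  length \<open>n\<close>.
\<close>
lemma direct_sum_alg:
  fixes x :: "nat list \<Rightarrow> 'k::field"
  assumes x: "x \<in> carrier alg"
  shows "\<exists>!f. (\<forall>n. f n \<in> component n) \<and> finite {n. f n \<noteq> zero alg} \<and>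
             x = finsum alg f {n. f n \<noteq> zero alg}"
proof (rule ex1I)
  let ?c = "\<lambda>n w. if length w = n then x w else 0"
  have c: "?c n \<in> component n" for n
  proof -
    have "finite {w. ?c n w \<noteq> 0}"
      by (rule finite_subset[of _ "{w. x w \<noteq> 0}"]) (use x in \<open>auto simp: carrier_alg\<close>)
    then show ?thesis
      using x by (auto simp: component_def carrier_alg)
  qed
  have fin: "finite {n. ?c n \<noteq> zero alg}"
  proof (rule finite_surj)
    show "finite {w. x w \<noteq> 0}" using x by (simp add: carrier_alg)
    show "{n. ?c n \<noteq> zero alg} \<subseteq> length ` {w. x w \<noteq> 0}"
      by (auto simp: alg_simps fun_eq_iff split: if_splits)
  qed
  have "finsum alg ?c {n. ?c n \<noteq> zero alg} = (\<lambda>w. \<Sum>n\<in>{n. ?c n \<noteq> zero alg}. ?c n w)"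
  proof (rule finsum_alg[OF fin], rule Pi_I)
    show "?c n \<in> carrier alg" for n
      using c[of n] unfolding component_def by blast
  qed
  also have "\<dots> = x"
    using fin by (auto simp: fun_eq_iff sum.delta' alg_simps)
  finally show "(\<forall>n. ?c n \<in> component n) \<and> finite {n. ?c n \<noteq> zero alg} \<and>
             x = finsum alg ?c {n. ?c n \<noteq> zero alg}"
    using c fin by auto
next
  fix f :: "nat \<Rightarrow> nat list \<Rightarrow> 'k"
  let ?D = "{n. f n \<noteq> zero alg}"
  assume f: "(\<forall>n. f n \<in> component n) \<and> finite ?D \<and> x = finsum alg f ?D"
  have "f \<in> ?D \<rightarrow> carrier alg" "finite ?D"
    using f unfolding component_def by blast+
  then have "finsum alg f ?D = (\<lambda>w. \<Sum>n\<in>?D. f n w)"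
    by (intro finsum_alg)
  then have x': "x w = (\<Sum>n\<in>?D. f n w)" for w
    using f by simp
  have zero: "f n w = 0" if "length w \<noteq> n" for n w
    using f that by (auto simp: component_def)
  then have "x w = (\<Sum>n\<in>?D. if n = length w then f (length w) w else 0)" for w
    unfolding x' using zero by (intro sum.cong) auto
  moreover have "finite ?D" using f by blast
  ultimately have "x w = f (length w) w" for w
    by (auto simp: alg_simps)
  then show "f = (\<lambda>n w. if length w = n then x w else 0)"
    using zero by (auto simp: fun_eq_iff)
qed

lemma component_0: "component 0 = {smult alg c (one alg) | c :: 'k::field. c \<in> carrier class_ring}"
proof -
  have "f = smult alg (f []) (one alg)" if "f \<in> component 0" for f :: "nat list \<Rightarrow> 'k"
    using that by (auto simp: component_def alg_simps monom_def fun_eq_iff)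
  moreover have "smult alg c (one alg) \<in> component 0" for c :: 'k
    using smult_closed[OF monom_carrier[OF Nil_normal], of c]
    by (auto simp: component_def alg_simps monom_def)
  ultimately show ?thesis by auto
qed

text \<open>
  A basis word is the product of its first letter and the normal form of the rest, which is shorter.
  The rest itself need not be in normal form, hence the induction on the length.
\<close>
lemma generated_carrier:
  fixes X :: "(nat list \<Rightarrow> 'k::field) set"
  assumes "X \<subseteq> carrier alg" and gen: "\<And>i. i < m \<Longrightarrow> monom [i] \<in> X"
  shows "generated_subalgebra class_ring alg X = carrier alg"
proof
  interpret ring "alg :: 'k word_algebra" by (rule ring_alg)
  have "subring (carrier alg) (alg :: 'k word_algebra)"
    by (rule carrier_is_subring)
  moreover have "VectorSpace.subspace class_ring (carrier alg) (alg :: 'k word_algebra)"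
    unfolding VectorSpace.subspace_def
    using vectorspace_alg
    by (auto intro!: submodule.intro simp: smult_closed vectorspace_def)
  ultimately show "generated_subalgebra class_ring alg X \<subseteq> carrier alg"
    using assms(1) by (auto simp: generated_subalgebra_def)
next
  show "carrier alg \<subseteq> generated_subalgebra class_ring alg X"
    unfolding generated_subalgebra_def
  proof (intro Inter_greatest)
    fix S assume "S \<in> {S. subring S (alg :: 'k word_algebra) \<and> VectorSpace.subspace class_ring S alg \<and> X \<subseteq> S}"
    then have S: "subring S (alg :: 'k word_algebra)" "submodule class_ring S alg" "X \<subseteq> S"
      by (auto simp: VectorSpace.subspace_def)
    interpret S: submodule class_ring S "alg :: 'k word_algebra" by (rule S(2))
    interpret R: ring "alg :: 'k word_algebra" by (rule ring_alg)
    have monom_S: "monom w \<in> S" if "w \<in> normal_words" for w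
      using that
    proof (induction "length w" arbitrary: w)
      case 0
      then show ?case using subringE(3)[OF S(1)] by (simp add: alg_simps)
    next
      case (Suc n)
      then obtain i v where w: "w = [i] @ v" by (cases w) auto
      have w_M: "[i] @ v \<in> M" and nf: "nf ([i] @ v) = w"
        using Suc.prems unfolding w normal_words_def by blast+
      note M = w_M append_memD1[OF w_M] append_memD2[OF w_M]
      have i: "i < m" using letters[OF M(2)] by simp
      have "monom (nf v) \<in> S"
        using Suc(2) w by (intro Suc(1) nf_normal M) (simp add: length_nf)
      moreover have "monom [i] \<in> S" using gen[OF i] S by auto
      ultimately have "mult alg (monom [i]) (monom (nf v)) \<in> S"
        by (intro subringE(6)[OF S(1)])
      moreover have "[i] @ nf v \<in> M"
        using M(1) nf_mem nf_append_right by metis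
      ultimately show ?case
        using nf_append_right[of "[i]" v] nf
        by (simp add: mult_monom letter_normal[OF i] nf_normal[OF M(3)])
    qed
    show "carrier alg \<subseteq> S"
    proof
      fix f :: "nat list \<Rightarrow> 'k" assume f: "f \<in> carrier alg"
      define A where "A = {w. f w \<noteq> 0}"
      have "finite A" "A \<subseteq> normal_words" "\<And>w. w \<notin> A \<Longrightarrow> f w = 0"
        using f by (auto simp: A_def carrier_alg)
      then show "f \<in> S"
      proof (induction A arbitrary: f)
        case empty
        then have "f = zero alg" by (auto simp: alg_simps)
        then show ?case using S.zero_closed by simp
      next
        case (insert u A)
        have "f(u := 0) \<in> S"
          using insert by (intro insert.IH) auto
        moreover have "smult alg (f u) (monom u) \<in> S"
          using insert.prems by (intro S.smult_closed monom_S) auto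
        ultimately have "add alg (f(u := 0)) (smult alg (f u) (monom u)) \<in> S"
          by (rule S.m_closed)
        also have "add alg (f(u := 0)) (smult alg (f u) (monom u)) = f"
          by (auto simp: alg_simps monom_def)
        finally show ?case .
      qed
    qed
  qed
qed

lemma graded_algebra_alg: "graded_algebra class_ring (alg :: 'k::field word_algebra) component"
proof (intro graded_algebra.intro assoc_algebra_alg graded_algebra_axioms.intro)
  show "mult alg x y \<in> component (i + j)"
    if "x \<in> component i" "y \<in> component j" for i j and x y :: "nat list \<Rightarrow> 'k"
    using that mult_closed mult_degree[of x y] by (auto simp: component_def)
  show "component 0 = {zero alg} \<or>
    component 0 = {smult alg c (one alg) | c :: 'k. c \<in> carrier class_ring}"
    using component_0 by blast
  show "generated_subalgebra class_ring (alg :: 'k word_algebra) (component 1) = carrier alg"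
    by (rule generated_carrier)
      (auto simp: component_def monom_carrier letter_normal, auto simp: monom_def split: if_splits)
qed (auto simp: component_subspace direct_sum_alg)

lemma generated_graded_algebra_alg:
  "generated_graded_algebra m class_ring (alg :: 'k::field word_algebra) component"
  unfolding generated_graded_algebra_def
proof (intro conjI graded_algebra_alg exI)
  let ?x = "\<lambda>i. monom [i] :: nat list \<Rightarrow> 'k"
  show "?x ` {..<m} \<subseteq> component 1"
    by (auto simp: component_def monom_carrier letter_normal, auto simp: monom_def split: if_splits)
  then show "generated_subalgebra class_ring alg (?x ` {..<m}) = carrier alg"
    by (intro generated_carrier) (auto simp: component_def)
qed

text \<open>
  The basis words of length \<open>n\<close> form a basis of the component, coordinates being function values. This
  is where the Hilbert series becomes a count of words.
\<close>
lemma dim_component: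
  "vectorspace.dim class_ring (alg\<lparr>carrier := component n\<rparr> :: 'k::field word_algebra)
    = card {w \<in> normal_words. length w = n}"
proof -
  let ?B = "{w \<in> normal_words. length w = n}"
  let ?V = "alg\<lparr>carrier := component n\<rparr> :: 'k word_algebra"
  let ?A = "(monom :: _ \<Rightarrow> _ \<Rightarrow> 'k) ` ?B"
  interpret V: vectorspace class_ring ?V
    by (rule vectorspace.subspace_is_vs[OF vectorspace_alg component_subspace])
  have inj: "inj_on (monom :: _ \<Rightarrow> _ \<Rightarrow> 'k) ?B"
    by (auto simp: inj_on_def monom_def fun_eq_iff)
  have fin: "finite ?A"
    using finite_normal_degree by blast
  have sub: "?A \<subseteq> carrier ?V"
    by (auto simp: component_def monom_carrier, auto simp: monom_def split: if_splits)
  \<comment> \<open>Sums in the component are sums in the whole algebra, computed pointwise.\<close>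
  have finsum_V: "finsum ?V F C = (\<lambda>w. \<Sum>i\<in>C. F i w)" if "finite C" "F \<in> C \<rightarrow> carrier ?V"
    for F :: "(nat list \<Rightarrow> 'k) \<Rightarrow> _" and C
    using that
  proof (induction C)
    case empty
    then show ?case by (simp add: alg_simps)
  next
    case (insert x A)
    then have "finsum ?V F (insert x A) = add ?V (F x) (finsum ?V F A)"
      by (intro V.finsum_insert) auto
    with insert show ?case by (simp add: alg_simps)
  qed
  have lincomb: "V.lincomb a ?A w = (if w \<in> ?B then a (monom w) else 0)" for a w
  proof -
    have "V.lincomb a ?A = (\<lambda>w. \<Sum>v\<in>?A. smult ?V (a v) v w)"
      unfolding V.lincomb_def
    proof (intro finsum_V fin Pi_I)
      show "smult ?V (a v) v \<in> carrier ?V" if "v \<in> ?A" for v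
        by (rule V.smult_closed) (use sub that in auto)
    qed
    then have "V.lincomb a ?A w = (\<Sum>u\<in>?B. a (monom u) * monom u w)"
      by (simp add: sum.reindex[OF inj] alg_simps)
    also have "\<dots> = (\<Sum>u\<in>?B. if u = w then a (monom w) else 0)"
      by (rule sum.cong) (auto simp: monom_def)
    finally show ?thesis using finite_normal_degree by simp
  qed
  have "V.basis ?A"
    unfolding V.basis_criterion[OF fin sub]
  proof (intro allI impI)
    fix v assume "v \<in> carrier ?V"
    then have v: "v w = 0" if "w \<notin> ?B" for w
      using that by (auto simp: component_def carrier_alg)
    show "\<exists>!a. a \<in> ?A \<rightarrow>\<^sub>E carrier class_ring \<and> V.lincomb a ?A = v"
    proof (rule ex1I)
      let ?a = "restrict (\<lambda>f. v (the_inv_into ?B monom f)) ?A"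
      show "?a \<in> ?A \<rightarrow>\<^sub>E carrier class_ring \<and> V.lincomb ?a ?A = v"
        using v by (auto simp: lincomb fun_eq_iff the_inv_into_f_f[OF inj])
      fix a assume a: "a \<in> ?A \<rightarrow>\<^sub>E carrier class_ring \<and> V.lincomb a ?A = v"
      show "a = ?a"
      proof (rule PiE_ext)
        show "a \<in> ?A \<rightarrow>\<^sub>E UNIV" "?a \<in> ?A \<rightarrow>\<^sub>E UNIV" using a by auto
        fix f assume f: "f \<in> ?A"
        then obtain w where w: "w \<in> ?B" "f = monom w" by blast
        then have "a f = V.lincomb a ?A w" by (simp add: lincomb)
        then show "a f = ?a f" using a w by (simp add: the_inv_into_f_f[OF inj])
      qed
    qed
  qed
  then have "V.dim = card ?A" by (rule V.dim_basis[OF fin])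
  then show ?thesis by (simp add: card_image[OF inj])
qed

end

section \<open>Commuting letters with a separator\<close>

text \<open>
  The letter \<open>d\<close> plays the part of \<open>y\<close>. Insertion moves a letter below \<open>d\<close> rightwards past smaller
  letters only, so it stops at the next \<open>d\<close>; each block between two letters \<open>d\<close> is thus
  sorted by itself, and concatenation laws follow by induction from the fold.
\<close>
definition sort_blocks :: "nat \<Rightarrow> nat list \<Rightarrow> nat list" where
  "sort_blocks d w = foldr (\<lambda>x ys. if x < d then insort x ys else x # ys) w []"

lemma sort_blocks_simps [simp]:
  "sort_blocks d [] = []"
  "sort_blocks d (x # w) = (if x < d then insort x (sort_blocks d w) else x # sort_blocks d w)"
  by (simp_all add: sort_blocks_def)

lemma mset_sort_blocks: "mset (sort_blocks d w) = mset w"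
  by (induction w) simp_all

lemma length_sort_blocks: "length (sort_blocks d w) = length w"
  by (induction w) simp_all

lemma set_sort_blocks: "set (sort_blocks d w) = set w"
  using mset_sort_blocks by (metis set_mset_mset)

lemma count_list_sort_blocks: "count_list (sort_blocks d w) x = count_list w x"
  using mset_sort_blocks by (metis count_mset)

text \<open>
  Sorting from the right absorbs an insertion made before: insertions of letters below \<open>d\<close> commute
  with each other.
\<close>
lemma sort_blocks_insort_append:
  assumes "x < d"
  shows "sort_blocks d (insort x ys @ v) = insort x (sort_blocks d (ys @ v))"
  using assms by (induction ys) (auto simp: insort_left_comm)

lemma sort_blocks_append_left: "sort_blocks d (sort_blocks d u @ v) = sort_blocks d (u @ v)"
  by (induction u) (simp_all add: sort_blocks_insort_append)

lemma sort_blocks_idem: "sort_blocks d (sort_blocks d w) = sort_blocks d w"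
  using sort_blocks_append_left[of d w "[]"] by simp

lemma sort_blocks_append_right: "sort_blocks d (u @ sort_blocks d v) = sort_blocks d (u @ v)"
  by (induction u) (simp_all add: sort_blocks_idem)

lemma insort_append_greater: "x < d \<Longrightarrow> insort x (u @ d # v) = insort x u @ d # v"
  for d :: nat
  by (induction u) auto

lemma sort_blocks_separator:
  "sort_blocks d (u @ d # v) = sort_blocks d u @ d # sort_blocks d v"
  by (induction u) (simp_all add: insort_append_greater)

lemma sort_blocks_eq_sort: "set w \<subseteq> {..<d} \<Longrightarrow> sort_blocks d w = sort w"
  by (induction w) simp_all

definition block_sorted :: "nat \<Rightarrow> nat list set" where
  "block_sorted d = {w. set w \<subseteq> {..<d} \<and> sorted w}"

lemma block_sorted_iff: "set w \<subseteq> {..<d} \<Longrightarrow> sort_blocks d w = w \<longleftrightarrow> w \<in> block_sorted d"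
  by (metis (mono_tags, lifting) block_sorted_def mem_Collect_eq sort_blocks_eq_sort sorted_sort
      sorted_sort_id)

lemma separator_eq_iff:
  assumes "d \<notin> set u" "d \<notin> set u'"
  shows "u @ d # r = u' @ d # r' \<longleftrightarrow> u = u' \<and> r = r'"
  using assms
proof (induction u arbitrary: u')
  case Nil
  then show ?case by (cases u') auto
next
  case (Cons a u)
  then show ?case by (cases u') auto
qed

lemma split_first_separator:
  assumes "count_list w d = Suc k"
  obtains u r where "w = u @ d # r" "d \<notin> set u" "count_list r d = k"
proof -
  have "d \<in> set w" using assms by (metis count_notin nat.distinct(1))
  then obtain u r where "w = u @ d # r" "d \<notin> set u" by (meson split_list_first)
  with assms that show ?thesis by (simp add: count_list_append)
qed

section \<open>The nonzero words\<close>

text \<open>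
  The conditions on \<open>z\<close> and \<open>u\<close> are the relations \<open>y v y x\<^sub>i = 0\<close> and \<open>x\<^sub>i y v y = 0\<close>. Quantifying over
  all ways to find two separators makes closure under factors immediate; the bound on the number of separators
  leaves at most one such way.
\<close>
definition surviving :: "nat \<Rightarrow> nat \<Rightarrow> nat list set \<Rightarrow> nat list set" where
  "surviving d p W = {w. set w \<subseteq> {..d} \<and> count_list w d \<le> 2 \<and>
     (\<forall>u v z. w = u @ d # v @ d # z \<longrightarrow>
        sort_blocks d v \<in> W \<and> (p < 2 \<longrightarrow> z = []) \<and> (p < 1 \<longrightarrow> u = []))}"

lemma survivingD:
  assumes "u @ d # v @ d # z \<in> surviving d p W"
  shows "sort_blocks d v \<in> W" "p < 2 \<Longrightarrow> z = []" "p < 1 \<Longrightarrow> u = []"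
  using assms by (auto simp: surviving_def)

lemma surviving_few_separators:
  assumes "count_list w d < 2"
  shows "w \<in> surviving d p W \<longleftrightarrow> set w \<subseteq> {..d}"
  using assms by (auto simp: surviving_def count_list_append)

lemma surviving_two_separators:
  assumes "d \<notin> set u" "d \<notin> set v" "d \<notin> set z"
  shows "u @ d # v @ d # z \<in> surviving d p W \<longleftrightarrow>
    set u \<subseteq> {..d} \<and> set v \<subseteq> {..d} \<and> set z \<subseteq> {..d} \<and>
    sort_blocks d v \<in> W \<and> (p < 2 \<longrightarrow> z = []) \<and> (p < 1 \<longrightarrow> u = [])" (is "?l \<longleftrightarrow> ?r")
proof
  assume ?l
  then show ?r using survivingD[of u d v z p W] by (auto simp: surviving_def)
next
  assume r: ?r
  have "u' = u \<and> v' = v \<and> z' = z" if eq: "u @ d # v @ d # z = u' @ d # v' @ d # z'" for u' v' z'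
  proof -
    have "count_list (u @ d # v @ d # z) d = 2"
      using assms by (simp add: count_list_append count_notin)
    then have "count_list (u' @ d # v' @ d # z') d = 2" using eq by simp
    then have "d \<notin> set u'" "d \<notin> set v'"
      by (auto simp: count_list_append count_list_0_iff)
    with eq assms show ?thesis by (simp add: separator_eq_iff)
  qed
  moreover have "count_list (u @ d # v @ d # z) d \<le> 2"
    using assms by (simp add: count_list_append count_notin)
  ultimately show ?l using r unfolding surviving_def by auto
qed

lemma separator_cases:
  assumes "count_list w d \<le> 2"
  obtains (none) "d \<notin> set w"
  | (one) u v where "w = u @ d # v" "d \<notin> set u" "d \<notin> set v"
  | (two) u v z where "w = u @ d # v @ d # z" "d \<notin> set u" "d \<notin> set v" "d \<notin> set z"
proof -
  consider "count_list w d = 0" | "count_list w d = Suc 0" | "count_list w d = Suc (Suc 0)"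
    using assms by linarith
  then show ?thesis
  proof cases
    case 1
    then show ?thesis using none by (simp add: count_list_0_iff)
  next
    case 2
    then show ?thesis using one by (metis split_first_separator count_list_0_iff)
  next
    case 3
    then show ?thesis using two by (metis split_first_separator count_list_0_iff)
  qed
qed

text \<open>
  Sorting keeps the separators and acts on each block, and the conditions on a block depend only on
  its sorted form or on whether it is empty.
\<close>
lemma sort_blocks_surviving: "sort_blocks d w \<in> surviving d p W \<longleftrightarrow> w \<in> surviving d p W"
proof (cases "count_list w d \<le> 2")
  case False
  then show ?thesis by (simp add: surviving_def count_list_sort_blocks)
next
  case True
  then show ?thesis
  proof (cases rule: separator_cases)
    case none
    then show ?thesis
      by (simp add: surviving_few_separators set_sort_blocks count_list_sort_blocks count_notin)
  next
    case one
    then have "count_list w d < 2" by (simp add: count_list_append count_notin)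
    then show ?thesis
      by (simp add: surviving_few_separators set_sort_blocks count_list_sort_blocks)
  next
    case (two u v z)
    have nil: "sort_blocks d x = [] \<longleftrightarrow> x = []" for x
      using length_sort_blocks[of d x] by auto
    show ?thesis
      using two(2-4) unfolding two(1)
      by (simp add: sort_blocks_separator surviving_two_separators set_sort_blocks sort_blocks_idem nil)
  qed
qed

lemma monomial_quotient_surviving:
  assumes "d > 0"
  shows "monomial_quotient (d + 1) (sort_blocks d) (surviving d p W)"
proof
  fix u v assume uv: "u @ v \<in> surviving d p W"
  then have basic: "set u \<subseteq> {..d}" "set v \<subseteq> {..d}" "count_list u d \<le> 2" "count_list v d \<le> 2"
    by (auto simp: surviving_def count_list_append)
  have "sort_blocks d b \<in> W \<and> (p < 2 \<longrightarrow> c = []) \<and> (p < 1 \<longrightarrow> a = [])"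
    if "u = a @ d # b @ d # c" for a b c
    using uv survivingD[of a d b "c @ v"] unfolding that by auto
  with basic show "u \<in> surviving d p W" unfolding surviving_def by blast
  have "sort_blocks d b \<in> W \<and> (p < 2 \<longrightarrow> c = []) \<and> (p < 1 \<longrightarrow> a = [])"
    if "v = a @ d # b @ d # c" for a b c
    using uv survivingD[of "u @ a" d b c] unfolding that by auto
  with basic show "v \<in> surviving d p W" unfolding surviving_def by blast
next
  show "[i] \<in> surviving d p W" if "i < d + 1" for i
    using that by (subst surviving_few_separators) auto
  show "[] \<in> surviving d p W"
    by (subst surviving_few_separators) auto
  show "set w \<subseteq> {..<d + 1}" if "w \<in> surviving d p W" for w
    using that by (auto simp: surviving_def)
qed (simp_all add: length_sort_blocks sort_blocks_append_left sort_blocks_append_right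
    sort_blocks_surviving)

section \<open>Counting words by length\<close>

definition word_series :: "nat list set \<Rightarrow> rat fps" where
  "word_series A = Abs_fps (\<lambda>n. of_nat (card {w \<in> A. length w = n}))"

lemma finite_words_of_length:
  fixes d :: nat
  assumes "A \<subseteq> lists {..d}"
  shows "finite {w \<in> A. length w = n}"
  by (rule finite_subset[OF _ finite_lists_length_eq[of "{..d}" n]]) (use assms in auto)

lemma word_series_Un:
  assumes "A \<subseteq> lists {..d}" "B \<subseteq> lists {..d}" "A \<inter> B = {}"
  shows "word_series (A \<union> B) = word_series A + word_series B"
proof (rule fps_ext)
  fix n
  have "{w \<in> A \<union> B. length w = n} = {w \<in> A. length w = n} \<union> {w \<in> B. length w = n}" by auto
  then have "card {w \<in> A \<union> B. length w = n} = card {w \<in> A. length w = n} + card {w \<in> B. length w = n}"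
    using assms by (simp add: card_Un_disjoint finite_words_of_length disjoint_iff)
  then show "fps_nth (word_series (A \<union> B)) n = fps_nth (word_series A + word_series B) n"
    by (simp add: word_series_def)
qed

definition join :: "nat \<Rightarrow> nat list set \<Rightarrow> nat list set \<Rightarrow> nat list set" where
  "join d A B = {u @ d # v | u v. u \<in> A \<and> v \<in> B}"

text \<open>
  As the words of \<open>A\<close> do not contain \<open>d\<close>, a word of the join determines both parts: they are separated
  by its first \<open>d\<close>. The separator itself accounts for the factor \<open>fps_X\<close>.
\<close>
lemma word_series_join:
  assumes A: "A \<subseteq> lists {..<d}" and B: "B \<subseteq> lists {..d}"
  shows "word_series (join d A B) = fps_X * (word_series A * word_series B)"
proof (rule fps_ext)
  fix n
  show "fps_nth (word_series (join d A B)) n = fps_nth (fps_X * (word_series A * word_series B)) n"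
  proof (cases n)
    case 0
    then show ?thesis by (simp add: word_series_def join_def)
  next
    case (Suc k)
    let ?A = "\<lambda>i. {w \<in> A. length w = i}" and ?B = "\<lambda>i. {w \<in> B. length w = i}"
    let ?S = "SIGMA i:{0..k}. ?A i \<times> ?B (k - i)"
    have A': "A \<subseteq> lists {..d}" by (rule order_trans[OF A lists_mono]) auto
    have "d \<notin> set u" if "u \<in> A" for u
      using A that by (auto simp: lists_eq_set)
    then have "inj_on (\<lambda>(i, u, v). u @ d # v) ?S"
      by (auto simp: inj_on_def separator_eq_iff)
    moreover have "{w \<in> join d A B. length w = n} = (\<lambda>(i, u, v). u @ d # v) ` ?S"
    proof
      show "{w \<in> join d A B. length w = n} \<subseteq> (\<lambda>(i, u, v). u @ d # v) ` ?S"
      proof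
        fix w assume "w \<in> {w \<in> join d A B. length w = n}"
        then obtain u v where "w = u @ d # v" "u \<in> A" "v \<in> B" "length u + length v = k"
          using Suc by (auto simp: join_def)
        then show "w \<in> (\<lambda>(i, u, v). u @ d # v) ` ?S"
          by (intro image_eqI[of _ _ "(length u, u, v)"]) auto
      qed
    qed (auto simp: join_def Suc)
    ultimately have "card {w \<in> join d A B. length w = n} = card ?S"
      by (simp add: card_image)
    also have "\<dots> = (\<Sum>i=0..k. card (?A i) * card (?B (k - i)))"
      using finite_words_of_length[OF A'] finite_words_of_length[OF B]
      by (simp add: card_SigmaI card_cartesian_product)
    finally have "fps_nth (word_series (join d A B)) n = fps_nth (word_series A * word_series B) k"
      by (simp add: word_series_def fps_mult_nth)
    then show ?thesis by (simp add: Suc)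
  qed
qed

text \<open>
  Sorted words are multisets of letters, that is, monomials in commuting variables.
\<close>
lemma card_sorted_words:
  "card {w. set w \<subseteq> {..<d} \<and> sorted w \<and> length w = n} = (d + n - 1) choose n" for d :: nat
proof -
  have "bij_betw mset {w. set w \<subseteq> {..<d} \<and> sorted w \<and> length w = n} (multisets_of_size {..<d} n)"
    by (rule bij_betw_byWitness[where f' = sorted_list_of_multiset])
      (auto simp: multisets_of_size_def sorted_list_of_multiset_mset sorted_sort_id simp flip: size_mset)
  then show ?thesis
    using card_multisets_of_size[of "{..<d}" n] by (simp add: bij_betw_same_card)
qed

lemma word_series_sorted:
  assumes "d > 0"
  shows "word_series (block_sorted d) = inverse ((1 - fps_X) ^ d)"
  using one_minus_const_fps_X_neg_power'[OF assms, of "1 :: rat"]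
  by (simp add: word_series_def block_sorted_def card_sorted_words conj_assoc)

lemma word_series_Nil: "word_series {[]} = 1"
  by (rule fps_ext) (auto simp: word_series_def Collect_conv_if)

section \<open>The normal words and their series\<close>

text \<open>
  The three parts are the normal words with no, one and two separators. A word is in normal
  form exactly if each of its blocks is sorted.
\<close>
lemma normal_surviving:
  assumes W: "W \<subseteq> block_sorted d"
  shows "{w \<in> surviving d p W. sort_blocks d w = w} =
    block_sorted d \<union> join d (block_sorted d) (block_sorted d) \<union>
    join d (if p < 1 then {[]} else block_sorted d)
      (join d W (if p < 2 then {[]} else block_sorted d))"
    (is "?N = ?S \<union> join d ?S ?S \<union> join d ?U (join d W ?Z)")
proof (rule Set.set_eqI)
  fix w
  have small: "set u \<subseteq> {..<d}" if "set u \<subseteq> {..d}" "d \<notin> set u" for u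
    using that by (force simp: le_less)
  have sep: "d \<notin> set u \<and> set u \<subseteq> {..d} \<and> sort_blocks d u = u" if "u \<in> ?S" for u
    using that block_sorted_iff[of u d] by (fastforce simp: block_sorted_def)
  have mem: "u \<in> ?S" if "set u \<subseteq> {..d}" "d \<notin> set u" "sort_blocks d u = u" for u
    using small[OF that(1,2)] that(3) by (simp add: block_sorted_iff)
  show "w \<in> ?N \<longleftrightarrow> w \<in> ?S \<union> join d ?S ?S \<union> join d ?U (join d W ?Z)"
  proof
    assume w: "w \<in> ?N"
    then have "count_list w d \<le> 2" by (simp add: surviving_def)
    then show "w \<in> ?S \<union> join d ?S ?S \<union> join d ?U (join d W ?Z)"
    proof (cases rule: separator_cases)
      case none
      with w show ?thesis by (auto simp: surviving_def intro: mem)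
    next
      case (one u v)
      with w have "u \<in> ?S" "v \<in> ?S"
        by (auto simp: surviving_def sort_blocks_separator separator_eq_iff set_sort_blocks intro!: mem)
      with one show ?thesis by (auto simp: join_def)
    next
      case (two u v z)
      have eq: "sort_blocks d u = u" "sort_blocks d v = v" "sort_blocks d z = z"
        using w two(2-) unfolding two(1)
        by (auto simp: sort_blocks_separator separator_eq_iff set_sort_blocks)
      have "set u \<subseteq> {..d}" "set z \<subseteq> {..d}" "sort_blocks d v \<in> W" "p < 2 \<longrightarrow> z = []" "p < 1 \<longrightarrow> u = []"
        using w surviving_two_separators[OF two(2-)] unfolding two(1) by auto
      then have "u \<in> ?U" "v \<in> W" "z \<in> ?Z"
        using eq mem[OF _ two(2)] mem[OF _ two(4)] by auto
      then show ?thesis unfolding two(1) join_def by blast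
    qed
  next
    assume "w \<in> ?S \<union> join d ?S ?S \<union> join d ?U (join d W ?Z)"
    then consider "w \<in> ?S" | u v where "w = u @ d # v" "u \<in> ?S" "v \<in> ?S"
      | u v z where "w = u @ d # v @ d # z" "u \<in> ?U" "v \<in> W" "z \<in> ?Z"
      by (auto simp: join_def)
    then show "w \<in> ?N"
    proof cases
      case 1
      then show ?thesis
        using sep[OF 1] by (auto intro!: surviving_few_separators[THEN iffD2] simp: count_notin)
    next
      case 2
      then show ?thesis
        using sep[OF 2(2)] sep[OF 2(3)]
        by (auto intro!: surviving_few_separators[THEN iffD2] simp: count_list_append count_notin sort_blocks_separator)
    next
      case 3
      have Nil: "[] \<in> ?S" by (simp add: block_sorted_def)
      have "u \<in> ?S" "v \<in> ?S" "z \<in> ?S"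
        using 3 W Nil by (auto split: if_splits)
      note * = sep[OF this(1)] sep[OF this(2)] sep[OF this(3)]
      have "w \<in> surviving d p W"
        unfolding 3(1) using * 3 by (subst surviving_two_separators) (auto split: if_splits)
      moreover have "sort_blocks d w = w"
        using * by (simp add: 3(1) sort_blocks_separator)
      ultimately show ?thesis by simp
    qed
  qed
qed

text \<open>
  Of the two outer factors, exactly \<open>p\<close> range over all sorted blocks, with series \<open>1 / (1 - t)\<^sup>d\<close>
  each; the others are empty words, with series \<open>1\<close>.
\<close>
lemma word_series_normal_surviving:
  assumes "d > 0" "W \<subseteq> block_sorted d" "p \<in> {0, 1, 2}"
  shows "word_series {w \<in> surviving d p W. sort_blocks d w = w} =
    1 / (1 - fps_X) ^ d + fps_X / (1 - fps_X) ^ (2 * d)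
      + fps_X ^ 2 * word_series W / (1 - fps_X) ^ (d * p)"
proof -
  let ?S = "block_sorted d"
  let ?U = "if p < 1 then {[]} else ?S" and ?Z = "if p < 2 then {[]} else ?S"
  let ?I = "inverse (1 - fps_X) :: rat fps"
  have S: "?S \<subseteq> lists {..<d}" by (auto simp: block_sorted_def)
  have U: "?U \<subseteq> lists {..<d}" and Z: "?Z \<subseteq> lists {..<d}" and W: "W \<subseteq> lists {..<d}"
    using S assms(2) by auto
  have up: "A \<subseteq> lists {..d}" if "A \<subseteq> lists {..<d}" for A
    by (rule order_trans[OF that lists_mono]) auto
  have join: "join d A B \<subseteq> lists {..d}" if "A \<subseteq> lists {..d}" "B \<subseteq> lists {..d}" for A B
    using that by (fastforce simp: join_def lists_eq_set)
  have count: "count_list w d = 0" if "A \<subseteq> lists {..<d}" "w \<in> A" for A w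
    using that by (auto simp: lists_eq_set count_list_0_iff)
  let ?c = "\<lambda>w. count_list w d"
  have c0: "?c w = 0" if "w \<in> ?S" for w
    using count[OF S that] .
  have c1: "?c w = 1" if "w \<in> join d ?S ?S" for w
    using that by (auto simp: join_def count_list_append c0)
  have c2: "?c w = 2" if "w \<in> join d ?U (join d W ?Z)" for w
    using that count[OF U] count[OF Z] count[OF W] by (auto simp: join_def count_list_append)
  \<comment> \<open>The number of separators tells the three parts apart.\<close>
  have disj1: "?S \<inter> join d ?S ?S = {}"
    using c0 c1 by fastforce
  have disj2: "(?S \<union> join d ?S ?S) \<inter> join d ?U (join d W ?Z) = {}"
    using c0 c1 c2 by fastforce
  have "word_series {w \<in> surviving d p W. sort_blocks d w = w} =
      word_series ?S + word_series (join d ?S ?S) + word_series (join d ?U (join d W ?Z))"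
    unfolding normal_surviving[OF assms(2)]
    by (simp only: word_series_Un[of _ d] disj1 disj2 up[OF S] up[OF U] up[OF W] up[OF Z] join Un_least)
  also have "\<dots> = word_series ?S + fps_X * (word_series ?S * word_series ?S)
      + fps_X * (word_series ?U * (fps_X * (word_series W * word_series ?Z)))"
    by (simp only: word_series_join S U W Z up[OF S] up[OF U] up[OF W] up[OF Z] join)
  also have "\<dots> = ?I ^ d + fps_X * ?I ^ (2 * d) + fps_X ^ 2 * word_series W * (word_series ?U * word_series ?Z)"
    unfolding mult_2 power_add
    by (simp add: word_series_sorted[OF assms(1)] fps_inverse_power power2_eq_square mult_ac)
  also have "word_series ?U * word_series ?Z = ?I ^ (d * p)"
    using assms(3) by (auto simp: word_series_Nil word_series_sorted[OF assms(1)] fps_inverse_power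
      mult_2_right power_add)
  finally show ?thesis
    by (simp add: fps_divide_unit fps_inverse_power)
qed

theorem theorem4:
  fixes a :: "nat \<Rightarrow> nat" and d p :: nat
  assumes "d > 0"
    and "\<And>n. a n \<le> (d + n - 1) choose n"
    and "p \<in> {0, 1, 2}"
  shows "\<exists>(R :: 'k::field word_algebra) G.
    generated_graded_algebra (d + 1) class_ring R G \<and>
    hilbert_series class_ring R G =
      1 / (1 - fps_X) ^ d
      + fps_X / (1 - fps_X) ^ (2 * d)
      + fps_X ^ 2 * Abs_fps (\<lambda>n. of_nat (a n)) / (1 - fps_X) ^ (d * p)"
proof -
  let ?T = "\<lambda>n. {w \<in> block_sorted d. length w = n}"
  have "\<exists>V. V \<subseteq> ?T n \<and> card V = a n" for n
  proof -
    have "card (?T n) = (d + n - 1) choose n"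
      using card_sorted_words[of d n] by (simp add: block_sorted_def conj_assoc)
    then have "a n \<le> card (?T n)" using assms(2)[of n] by simp
    then obtain V where "V \<subseteq> ?T n" "card V = a n" by (rule obtain_subset_with_card_n)
    then show ?thesis by blast
  qed
  then obtain V where V: "\<And>n. V n \<subseteq> ?T n" "\<And>n. card (V n) = a n" by metis
  define W where "W = (\<Union>n. V n)"
  have W: "W \<subseteq> block_sorted d" using V(1) by (auto simp: W_def)
  have "{w \<in> W. length w = n} = V n" for n
    using V(1) by (auto simp: W_def)
  then have series_W: "word_series W = Abs_fps (\<lambda>n. of_nat (a n))"
    by (simp add: word_series_def V(2))
  interpret monomial_quotient "d + 1" "sort_blocks d" "surviving d p W"
    by (rule monomial_quotient_surviving) (rule assms(1))
  have "hilbert_series class_ring (alg :: 'k word_algebra) component = word_series normal_words"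
    by (simp add: hilbert_series_def word_series_def dim_component)
  also have "\<dots> = 1 / (1 - fps_X) ^ d + fps_X / (1 - fps_X) ^ (2 * d)
      + fps_X ^ 2 * Abs_fps (\<lambda>n. of_nat (a n)) / (1 - fps_X) ^ (d * p)"
    unfolding normal_words_def
    using word_series_normal_surviving[OF assms(1) W assms(3)] by (simp add: series_W)
  finally show ?thesis
    using generated_graded_algebra_alg by blast
qed

end
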